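(* Let $n\ge1$ and let $\mathrm{EQ}:\{0,1\}^n\times\{0,1\}^n\to\{0,1\}$ be the equality function, $\mathrm{EQ}(x,y)=1$ iff $x=y$. Then $GH(\mathrm{EQ})\le 3n+1$.
   Context: Garden-hose game of size $s\in\mathbb{N}$: let $A=\{1^A,\dots,s^A\}$, $B=\{1^B,\dots,s^B\}$, $A_\circ=A\cup\{0\}$, and $E=\{\{i^A,i^B\}:1\le i\le s\}$ (the pipes). A game $G$ is given by functions $E_{A_\circ},E_B$ on $\{0,1\}^n$, where $E_{A_\circ}(x)$ is a set of edges (no self-loops) on $A_\circ$ and $E_B(y)$ is a set of edges (no self-loops) on $B$, such that the graphs $(A_\circ,E_{A_\circ}(x))$ and $(B,E_B(y))$ have maximum degree at most $1$. Put $G(x,y)=(A_\circ\cup B,\,E\cup E_{A_\circ}(x)\cup E_B(y))$. There is a unique maximal path $\pi(x,y)$ in $G(x,y)$ starting at $0$ (it consists of $0$ alone if $0$ has degree $0$). $G$ computes $f$ if for all $x,y$ the endpoint of $\pi(x,y)$ lies in $A_\circ$ when $f(x,y)=0$ and in $B$ when $f(x,y)=1$. $GH(f)$ is the smallest size $s$ of a game computing $f$. *)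

theory Defs
  imports Main "HOL-Library.Sublist" "HOL-Library.Extended_Nat"
begin

datatype vertex = Zero | PA nat | PB nat

definition sideA :: "nat \<Rightarrow> vertex set" where
  "sideA s = PA ` {1..s}"

definition sideA0 :: "nat \<Rightarrow> vertex set" where
  "sideA0 s = insert Zero (sideA s)"

definition sideB :: "nat \<Rightarrow> vertex set" where
  "sideB s = PB ` {1..s}"

definition pipes :: "nat \<Rightarrow> vertex set set" where
  "pipes s = {{PA i, PB i} | i. i \<in> {1..s}}"

definition simple_graph :: "'v set \<Rightarrow> 'v set set \<Rightarrow> bool" where
  "simple_graph V F \<longleftrightarrow> (\<forall>e\<in>F. e \<subseteq> V \<and> card e = 2)"

definition vertex_degree :: "'v set set \<Rightarrow> 'v \<Rightarrow> nat" where
  "vertex_degree F v = card {e \<in> F. v \<in> e}"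

definition is_path :: "'v set \<Rightarrow> 'v set set \<Rightarrow> 'v list \<Rightarrow> bool" where
  "is_path V F p \<longleftrightarrow> p \<noteq> [] \<and> set p \<subseteq> V \<and> distinct p \<and> successively (\<lambda>u v. {u, v} \<in> F) p"

definition maximal_path_from :: "'v set \<Rightarrow> 'v set set \<Rightarrow> 'v \<Rightarrow> 'v list \<Rightarrow> bool" where
  "maximal_path_from V F v p \<longleftrightarrow>
     is_path V F p \<and> hd p = v \<and> (\<forall>q. is_path V F q \<and> prefix p q \<longrightarrow> q = p)"

definition bits :: "nat \<Rightarrow> bool list set" where
  "bits n = {x. length x = n}"

text \<open>A game on inputs of length \<open>n\<close> is given by \<open>E\<^sub>A\<close> and \<open>E\<^sub>B\<close>; their values outside
  \<open>bits n\<close> are irrelevant.\<close>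

definition is_game ::
  "nat \<Rightarrow> nat \<Rightarrow> (bool list \<Rightarrow> vertex set set) \<Rightarrow> (bool list \<Rightarrow> vertex set set) \<Rightarrow> bool" where
  "is_game n s E\<^sub>A E\<^sub>B \<longleftrightarrow>
     (\<forall>x\<in>bits n. simple_graph (sideA0 s) (E\<^sub>A x) \<and> (\<forall>v\<in>sideA0 s. vertex_degree (E\<^sub>A x) v \<le> 1)) \<and>
     (\<forall>y\<in>bits n. simple_graph (sideB s) (E\<^sub>B y) \<and> (\<forall>v\<in>sideB s. vertex_degree (E\<^sub>B y) v \<le> 1))"

definition game_vertices :: "nat \<Rightarrow> vertex set" where
  "game_vertices s = sideA0 s \<union> sideB s"

definition game_edges ::
  "nat \<Rightarrow> (bool list \<Rightarrow> vertex set set) \<Rightarrow> (bool list \<Rightarrow> vertex set set) \<Rightarrow>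
   bool list \<Rightarrow> bool list \<Rightarrow> vertex set set" where
  "game_edges s E\<^sub>A E\<^sub>B x y = pipes s \<union> E\<^sub>A x \<union> E\<^sub>B y"

definition water_path ::
  "nat \<Rightarrow> (bool list \<Rightarrow> vertex set set) \<Rightarrow> (bool list \<Rightarrow> vertex set set) \<Rightarrow>
   bool list \<Rightarrow> bool list \<Rightarrow> vertex list" where
  "water_path s E\<^sub>A E\<^sub>B x y =
     (THE p. maximal_path_from (game_vertices s) (game_edges s E\<^sub>A E\<^sub>B x y) Zero p)"

definition computes ::
  "nat \<Rightarrow> nat \<Rightarrow> (bool list \<Rightarrow> vertex set set) \<Rightarrow> (bool list \<Rightarrow> vertex set set) \<Rightarrow>
   (bool list \<Rightarrow> bool list \<Rightarrow> bool) \<Rightarrow> bool" where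
  "computes n s E\<^sub>A E\<^sub>B f \<longleftrightarrow>
     (\<forall>x\<in>bits n. \<forall>y\<in>bits n.
        (\<not> f x y \<longrightarrow> last (water_path s E\<^sub>A E\<^sub>B x y) \<in> sideA0 s) \<and>
        (f x y \<longrightarrow> last (water_path s E\<^sub>A E\<^sub>B x y) \<in> sideB s))"

text \<open>The minimum is taken in \<^typ>\<open>enat\<close>, so that it would be \<open>\<infinity>\<close>, rather than an unspecified
  number, if no game computed \<open>f\<close>.\<close>

definition GH :: "nat \<Rightarrow> (bool list \<Rightarrow> bool list \<Rightarrow> bool) \<Rightarrow> enat" where
  "GH n f = Inf {enat s | s. \<exists>E\<^sub>A E\<^sub>B. is_game n s E\<^sub>A E\<^sub>B \<and> computes n s E\<^sub>A E\<^sub>B f}"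

definition EQ :: "bool list \<Rightarrow> bool list \<Rightarrow> bool" where
  "EQ x y \<longleftrightarrow> x = y"


text \<open>The description in \<^const>\<open>water_path\<close> is proper.\<close>

lemma card_le_vertex_degree:
  assumes "finite F" "{e1, e2, e3} \<subseteq> F" "v \<in> e1" "v \<in> e2" "v \<in> e3"
  shows "card {e1, e2, e3} \<le> vertex_degree F v"
  unfolding vertex_degree_def using assms by (intro card_mono) auto

lemma ex1_maximal_path:
  assumes fin: "finite V" "finite F" and v: "v \<in> V"
    and d1: "vertex_degree F v \<le> 1" and d2: "\<And>u. u \<in> V \<Longrightarrow> vertex_degree F u \<le> 2"
  shows "\<exists>!p. maximal_path_from V F v p"
proof (rule ex_ex1I)
  let ?P = "\<lambda>p. is_path V F p \<and> hd p = v"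
  have ex: "?P [v]" using v by (simp add: is_path_def)
  have bd: "length p \<le> card V" if "?P p" for p
  proof -
    have "length p = card (set p)" using that by (simp add: is_path_def distinct_card)
    also have "\<dots> \<le> card V" using that fin by (intro card_mono) (auto simp: is_path_def)
    finally show ?thesis .
  qed
  obtain p where p: "?P p" "\<And>q. ?P q \<Longrightarrow> length q \<le> length p"
    using ex_has_greatest_nat[of ?P "[v]" length "Suc (card V)"] ex bd by (metis less_Suc_eq_le)
  have "maximal_path_from V F v p"
    unfolding maximal_path_from_def
  proof (intro conjI allI impI)
    fix q assume q: "is_path V F q \<and> prefix p q"
    have "p \<noteq> []" using p(1) by (simp add: is_path_def)
    with q p(1) have "?P q" by (auto simp: prefix_def)
    from p(2)[OF this] q show "q = p" by (auto simp: prefix_def)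
  qed (use p in auto)
  thus "\<exists>p. maximal_path_from V F v p" ..
next
  fix p q assume mp: "maximal_path_from V F v p" and mq: "maximal_path_from V F v q"
  have P: "is_path V F p" "hd p = v" and Q: "is_path V F q" "hd q = v"
    using mp mq by (auto simp: maximal_path_from_def)
  show "p = q"
  proof (cases "p \<parallel> q")
    case False
    then show ?thesis using mp mq by (auto simp: maximal_path_from_def)
  next
    case True
    then obtain r a as b bs where ab: "a \<noteq> b" "p = r @ a # as" "q = r @ b # bs"
      using parallel_decomp by blast
    have "r \<noteq> []" using ab P(2) Q(2) by auto
    then obtain r' u where r: "r = r' @ [u]" by (metis rev_exhaust)
    have ua: "{u, a} \<in> F" and ub: "{u, b} \<in> F"
      using P(1) Q(1) ab r by (auto simp: is_path_def successively_append_iff)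
    have uab: "{u, a} \<noteq> {u, b}" using ab(1) by (auto simp: doubleton_eq_iff)
    have uV: "u \<in> V" using P(1) ab r by (auto simp: is_path_def)
    show ?thesis
    proof (cases r' rule: rev_cases)
      case Nil
      then have "u = v" using P(2) ab r by simp
      moreover have "card {{u, a}, {u, b}, {u, b}} \<le> vertex_degree F u"
        using fin ua ub by (intro card_le_vertex_degree) auto
      ultimately show ?thesis using d1 uab by simp
    next
      case (snoc r'' c)
      have uc: "{u, c} \<in> F" using P(1) ab r snoc
        by (auto simp: is_path_def successively_append_iff insert_commute)
      have "a \<noteq> c" "b \<noteq> c" using P(1) Q(1) ab r snoc by (auto simp: is_path_def)
      then have "card {{u, a}, {u, b}, {u, c}} = 3"
        using uab by (auto simp: doubleton_eq_iff card_insert_if)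
      moreover have "card {{u, a}, {u, b}, {u, c}} \<le> vertex_degree F u"
        using fin ua ub uc by (intro card_le_vertex_degree) auto
      ultimately show ?thesis using d2[OF uV] by simp
    qed
  qed
qed

lemma water_path_unique:
  assumes G: "is_game n s E\<^sub>A E\<^sub>B" and x: "x \<in> bits n" and y: "y \<in> bits n"
  shows "\<exists>!p. maximal_path_from (game_vertices s) (game_edges s E\<^sub>A E\<^sub>B x y) Zero p"
proof (rule ex1_maximal_path)
  have A: "e \<subseteq> sideA0 s" if "e \<in> E\<^sub>A x" for e
    using G x that by (auto simp: is_game_def simple_graph_def)
  have B: "e \<subseteq> sideB s" if "e \<in> E\<^sub>B y" for e
    using G y that by (auto simp: is_game_def simple_graph_def)
  have fA: "finite (E\<^sub>A x)" 
    by (rule finite_subset[of _ "Pow (sideA0 s)"]) (use A in \<open>auto simp: sideA0_def sideA_def\<close>)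
  have fB: "finite (E\<^sub>B y)" 
    by (rule finite_subset[of _ "Pow (sideB s)"]) (use B in \<open>auto simp: sideB_def\<close>)
  have fp: "finite (pipes s)" unfolding pipes_def by simp
  show "finite (game_vertices s)"
    by (simp add: game_vertices_def sideA0_def sideA_def sideB_def)
  show "finite (game_edges s E\<^sub>A E\<^sub>B x y)" using fA fB fp by (simp add: game_edges_def)
  show "Zero \<in> game_vertices s" by (simp add: game_vertices_def sideA0_def)
  have dA: "card {e \<in> E\<^sub>A x. v \<in> e} \<le> 1" if "v \<in> sideA0 s" for v
    using G x that by (auto simp: is_game_def vertex_degree_def)
  have dB: "card {e \<in> E\<^sub>B y. v \<in> e} \<le> 1" if "v \<in> sideB s" for v
    using G y that by (auto simp: is_game_def vertex_degree_def)
  have Z: "{e \<in> game_edges s E\<^sub>A E\<^sub>B x y. Zero \<in> e} = {e \<in> E\<^sub>A x. Zero \<in> e}"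
    using B by (fastforce simp: game_edges_def pipes_def sideB_def)
  show "vertex_degree (game_edges s E\<^sub>A E\<^sub>B x y) Zero \<le> 1"
    using dA[of Zero] by (simp add: vertex_degree_def Z sideA0_def)
  fix u assume u: "u \<in> game_vertices s"
  show "vertex_degree (game_edges s E\<^sub>A E\<^sub>B x y) u \<le> 2"
  proof (cases "u \<in> sideA0 s")
    case True
    then have "{e \<in> game_edges s E\<^sub>A E\<^sub>B x y. u \<in> e}
        \<subseteq> {e \<in> E\<^sub>A x. u \<in> e} \<union> (case u of PA i \<Rightarrow> {{PA i, PB i}} | _ \<Rightarrow> {})"
      using B by (fastforce simp: game_edges_def pipes_def sideB_def sideA0_def sideA_def split: vertex.splits)
    then have "card {e \<in> game_edges s E\<^sub>A E\<^sub>B x y. u \<in> e} \<le>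
        card ({e \<in> E\<^sub>A x. u \<in> e} \<union> (case u of PA i \<Rightarrow> {{PA i, PB i}} | _ \<Rightarrow> {}))"
      using fA by (intro card_mono) (auto split: vertex.splits)
    also have "\<dots> \<le> card {e \<in> E\<^sub>A x. u \<in> e} + card (case u of PA i \<Rightarrow> {{PA i, PB i}} | _ \<Rightarrow> {})"
      by (rule card_Un_le)
    also have "\<dots> \<le> 2" using dA[OF True] by (auto split: vertex.splits)
    finally show ?thesis by (simp add: vertex_degree_def)
  next
    case False
    then obtain i where i: "u = PB i" "u \<in> sideB s"
      using u by (auto simp: game_vertices_def sideB_def)
    then have "{e \<in> game_edges s E\<^sub>A E\<^sub>B x y. u \<in> e} \<subseteq> insert {PA i, PB i} {e \<in> E\<^sub>B y. u \<in> e}"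
      using A by (fastforce simp: game_edges_def pipes_def sideA0_def sideA_def)
    then have "card {e \<in> game_edges s E\<^sub>A E\<^sub>B x y. u \<in> e} \<le> card (insert {PA i, PB i} {e \<in> E\<^sub>B y. u \<in> e})"
      using fB by (intro card_mono) auto
    also have "\<dots> \<le> 2" using dB[OF i(2)] fB by (simp add: card_insert_if)
    finally show ?thesis by (simp add: vertex_degree_def)
  qed
qed

end

theory Submission
  imports Defs
begin

text \<open>Alice connects the tap to pipe \<open>1\<close>. For bit \<open>i\<close> the water arrives at Bob through pipe
  \<open>3i + 1\<close>; Bob sends it back through pipe \<open>3i + 2\<close> or \<open>3i + 3\<close> according to his bit, and Alice
  connects only the one of these two pipes that matches her bit to pipe \<open>3i + 4\<close>. At the first
  difference the water thus leaves through an open pipe on Alice's side, and if there is none, it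
  leaves on Bob's side through pipe \<open>3n + 1\<close>. Letting Bob send the bits is what saves a pipe:
  a mismatch then already ends on the correct side.\<close>

definition link_pipe :: "nat \<Rightarrow> nat" where
  "link_pipe i = 3 * i + 1"

definition bit_pipe :: "nat \<Rightarrow> bool \<Rightarrow> nat" where
  "bit_pipe i b = 3 * i + 2 + of_bool b"

text \<open>The values \<open>link_pipe i\<close> for i \<le> n and \<open>bit_pipe i b\<close> for
  i < n together list 1, ..., 3n + 1 once each. The rules below let the simplifier compare pipes
  without unfolding this arithmetic.\<close>

lemma link_pipe_eq_iff [simp]: "link_pipe i = link_pipe j \<longleftrightarrow> i = j"
  by (simp add: link_pipe_def)

lemma bit_pipe_eq_iff [simp]: "bit_pipe i b = bit_pipe j c \<longleftrightarrow> i = j \<and> b = c"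
  unfolding bit_pipe_def by (cases b; cases c; simp; presburger)

lemma bit_pipe_neq_link_pipe [simp]: "bit_pipe i b \<noteq> link_pipe j" "link_pipe j \<noteq> bit_pipe i b"
  unfolding bit_pipe_def link_pipe_def by (cases b; simp; presburger)+

lemma link_pipe_le_iff [simp]: "link_pipe i \<le> link_pipe n \<longleftrightarrow> i \<le> n"
  by (simp add: link_pipe_def)

lemma bit_pipe_le_iff [simp]: "bit_pipe i b \<le> link_pipe n \<longleftrightarrow> i < n"
  unfolding bit_pipe_def link_pipe_def by (cases b; simp; presburger)

lemma pipe_ge_1 [simp]: "Suc 0 \<le> link_pipe i" "Suc 0 \<le> bit_pipe i b"
  by (simp_all add: link_pipe_def bit_pipe_def)

definition eq_game_A :: "bool list \<Rightarrow> vertex set set" where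
  "eq_game_A x = insert {Zero, PA (link_pipe 0)}
     {{PA (bit_pipe i (x ! i)), PA (link_pipe (Suc i))} | i. i < length x}"

definition eq_game_B :: "bool list \<Rightarrow> vertex set set" where
  "eq_game_B y = {{PB (link_pipe i), PB (bit_pipe i (y ! i))} | i. i < length y}"

lemma vertex_degree_le_1:
  assumes "\<And>e e'. e \<in> F \<Longrightarrow> e' \<in> F \<Longrightarrow> v \<in> e \<Longrightarrow> v \<in> e' \<Longrightarrow> e = e'"
  shows "vertex_degree F v \<le> 1"
proof (cases "finite {e \<in> F. v \<in> e}")
  case True
  then show ?thesis
    using assms by (auto simp: vertex_degree_def card_le_Suc0_iff_eq)
\<comment> \<open>An infinite set has \<open>card\<close> 0, so here the bound holds by
  default.\<close>
qed (simp add: vertex_degree_def)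

lemma is_game_eq_game: "is_game n (link_pipe n) eq_game_A eq_game_B"
proof -
  have "simple_graph (sideA0 (link_pipe n)) (eq_game_A x)" if "x \<in> bits n" for x
    using that by (auto simp: simple_graph_def sideA0_def sideA_def eq_game_A_def bits_def)
  moreover have "simple_graph (sideB (link_pipe n)) (eq_game_B y)" if "y \<in> bits n" for y
    using that by (auto simp: simple_graph_def sideB_def eq_game_B_def bits_def)
  \<comment> \<open>A shared vertex determines the index \<open>i\<close>; the tap edge is at
    \<open>link_pipe 0\<close>, all other edges at some \<open>link_pipe (Suc i)\<close>.\<close>
  moreover have "vertex_degree (eq_game_A x) v \<le> 1" for x v
    by (rule vertex_degree_le_1) (auto simp: eq_game_A_def)
  moreover have "vertex_degree (eq_game_B y) v \<le> 1" for y v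
    by (rule vertex_degree_le_1) (auto simp: eq_game_B_def)
  ultimately show ?thesis by (simp add: is_game_def)
qed

text \<open>In a proper extension the vertex after \<open>last p\<close> would be a neighbour of it
  outside \<open>p\<close>, so maximality is a local check at the end.\<close>

lemma maximal_path_fromI:
  assumes p: "is_path V F p" and hd: "hd p = v"
    and last: "\<And>w. {last p, w} \<in> F \<Longrightarrow> w \<in> set p"
  shows "maximal_path_from V F v p"
  unfolding maximal_path_from_def
proof (intro conjI allI impI)
  fix q assume q: "is_path V F q \<and> prefix p q"
  then obtain r where r: "q = p @ r" by (auto simp: prefix_def)
  show "q = p"
  proof (cases r)
    case (Cons w ws)
    then have "{last p, w} \<in> F" "w \<notin> set p"
      using q r p by (auto simp: is_path_def successively_append_iff)
    then show ?thesis using last by blast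
  qed (simp add: r)
qed (use p hd in auto)

text \<open>By uniqueness, evaluating the description reduces to exhibiting one maximal
  path.\<close>

lemma water_path_eq:
  assumes "is_game n s E\<^sub>A E\<^sub>B" "x \<in> bits n" "y \<in> bits n"
    and "maximal_path_from (game_vertices s) (game_edges s E\<^sub>A E\<^sub>B x y) Zero p"
  shows "water_path s E\<^sub>A E\<^sub>B x y = p"
  unfolding water_path_def using water_path_unique[OF assms(1-3)] assms(4) by (rule the1_equality)

abbreviation eq_vertices :: "nat \<Rightarrow> vertex set" where
  "eq_vertices n \<equiv> game_vertices (link_pipe n)"

abbreviation eq_edges :: "nat \<Rightarrow> bool list \<Rightarrow> bool list \<Rightarrow> vertex set set" where
  "eq_edges n \<equiv> game_edges (link_pipe n) eq_game_A eq_game_B"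

text \<open>The water's route through \<open>k\<close> matching bits. Only Bob's string occurs,
  since Alice's bits agree with it there.\<close>

fun eq_path :: "bool list \<Rightarrow> nat \<Rightarrow> vertex list" where
  "eq_path y 0 = [Zero, PA (link_pipe 0), PB (link_pipe 0)]"
| "eq_path y (Suc k) = eq_path y k @
     [PB (bit_pipe k (y ! k)), PA (bit_pipe k (y ! k)), PA (link_pipe (Suc k)), PB (link_pipe (Suc k))]"

lemma eq_path_simps [simp]:
  "eq_path y k \<noteq> []" "hd (eq_path y k) = Zero" "last (eq_path y k) = PB (link_pipe k)"
  by (induction k) (auto simp: hd_append)

text \<open>Pipes are numbered block by block along the route, so this bound makes all pipes of
  later blocks fresh; distinctness of the extended path follows from it.\<close>

lemma set_eq_path:
  "v \<in> set (eq_path y k) \<Longrightarrow> v = Zero \<or> (\<exists>i \<le> link_pipe k. v = PA i \<or> v = PB i)"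
proof (induction k)
  case (Suc k)
  have "i \<le> link_pipe (Suc k)" if "i \<le> link_pipe k" for i
    using that by (simp add: link_pipe_def)
  with Suc show ?case by fastforce
qed auto

lemma notin_eq_path:
  assumes "link_pipe k < i"
  shows "PA i \<notin> set (eq_path y k)" "PB i \<notin> set (eq_path y k)"
  using assms set_eq_path[of _ y k] by fastforce+

lemma last_eq_path_pipe: "PA (link_pipe k) \<in> set (eq_path y k)"
  by (cases k) auto

lemma pipe_edge: "i \<in> {1..s} \<Longrightarrow> {PB i, PA i} \<in> game_edges s E\<^sub>A E\<^sub>B x y"
  by (auto simp: game_edges_def pipes_def insert_commute)

text \<open>Bob's half of a round uses only his edge and a pipe, whatever Alice's bit is. It
  therefore serves both the matching rounds and the round of the first mismatch.\<close>

lemma eq_path_step: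
  assumes "k < n" "length y = n" "is_path (eq_vertices n) (eq_edges n x y) (eq_path y k)"
  shows "is_path (eq_vertices n) (eq_edges n x y)
           (eq_path y k @ [PB (bit_pipe k (y ! k)), PA (bit_pipe k (y ! k))])"
proof -
  let ?j = "bit_pipe k (y ! k)"
  have "{PB (link_pipe k), PB ?j} \<in> eq_edges n x y"
    using assms(1,2) by (auto simp: game_edges_def eq_game_B_def)
  moreover have j: "?j \<in> {1..link_pipe n}" using assms(1) by simp
  then have "{PB ?j, PA ?j} \<in> eq_edges n x y" by (rule pipe_edge)
  moreover have "link_pipe k < ?j" by (simp add: link_pipe_def bit_pipe_def)
  moreover have "{PB ?j, PA ?j} \<subseteq> eq_vertices n"
    using j by (simp add: game_vertices_def sideA0_def sideA_def sideB_def)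
  ultimately show ?thesis
    using assms(3) by (simp add: is_path_def successively_append_iff notin_eq_path)
qed

lemma is_path_eq_path:
  assumes "length x = n" "length y = n" "k \<le> n" "\<And>i. i < k \<Longrightarrow> x ! i = y ! i"
  shows "is_path (eq_vertices n) (eq_edges n x y) (eq_path y k)"
  using assms(3,4)
proof (induction k)
  case 0
  have "{Zero, PA (link_pipe 0)} \<in> eq_edges n x y"
    by (simp add: game_edges_def eq_game_A_def)
  moreover have "{PB (link_pipe 0), PA (link_pipe 0)} \<in> eq_edges n x y"
    by (rule pipe_edge) simp
  ultimately show ?case
    by (simp add: is_path_def game_vertices_def sideA0_def sideA_def sideB_def insert_commute)
next
  case (Suc k)
  let ?j = "bit_pipe k (y ! k)" and ?l = "link_pipe (Suc k)"
  have "is_path (eq_vertices n) (eq_edges n x y) (eq_path y k @ [PB ?j, PA ?j])"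
    using Suc assms(2) by (intro eq_path_step) auto
  \<comment> \<open>Alice's edge starts at the pipe of her own bit; agreement at \<open>k\<close>
    makes this the pipe through which the water returns.\<close>
  moreover have "{PA (bit_pipe k (x ! k)), PA ?l} \<in> eq_edges n x y"
    using Suc.prems(1) assms(1) by (auto simp: game_edges_def eq_game_A_def)
  then have "{PA ?j, PA ?l} \<in> eq_edges n x y"
    using Suc.prems(2) by simp
  moreover have l: "?l \<in> {1..link_pipe n}" using Suc.prems(1) by simp
  then have "{PB ?l, PA ?l} \<in> eq_edges n x y" by (rule pipe_edge)
  then have "{PA ?l, PB ?l} \<in> eq_edges n x y" by (simp add: insert_commute)
  moreover have "link_pipe k < ?l" by (simp add: link_pipe_def)
  moreover have "{PB ?l, PA ?l} \<subseteq> eq_vertices n"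
    using l by (simp add: game_vertices_def sideA0_def sideA_def sideB_def)
  ultimately show ?case
    by (simp add: is_path_def successively_append_iff notin_eq_path)
qed

lemma water_path_eq_game_equal:
  assumes "x \<in> bits n"
  shows "water_path (link_pipe n) eq_game_A eq_game_B x x = eq_path x n"
proof (rule water_path_eq[OF is_game_eq_game assms assms], rule maximal_path_fromI)
  show "is_path (eq_vertices n) (eq_edges n x x) (eq_path x n)"
    using assms by (intro is_path_eq_path) (auto simp: bits_def)
  fix w assume "{last (eq_path x n), w} \<in> eq_edges n x x"
  \<comment> \<open>Bob's edges meet \<open>link_pipe i\<close> only for i < n, so the last link
    pipe is open on his side.\<close>
  then have "w = PA (link_pipe n)"
    using assms by (auto simp: game_edges_def pipes_def eq_game_A_def eq_game_B_def bits_def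
        doubleton_eq_iff)
  then show "w \<in> set (eq_path x n)" using last_eq_path_pipe by simp
qed simp

lemma water_path_eq_game_mismatch:
  assumes "x \<in> bits n" "y \<in> bits n" "k < n" "x ! k \<noteq> y ! k" "\<And>i. i < k \<Longrightarrow> x ! i = y ! i"
  shows "water_path (link_pipe n) eq_game_A eq_game_B x y =
    eq_path y k @ [PB (bit_pipe k (y ! k)), PA (bit_pipe k (y ! k))]" (is "_ = ?p")
proof (rule water_path_eq[OF is_game_eq_game assms(1,2)], rule maximal_path_fromI)
  show "is_path (eq_vertices n) (eq_edges n x y) ?p"
    using assms by (intro eq_path_step is_path_eq_path) (auto simp: bits_def)
  fix w assume "{last ?p, w} \<in> eq_edges n x y"
  \<comment> \<open>Alice's only edge at a bit pipe of block \<open>k\<close> is at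
    \<open>bit_pipe k (x ! k)\<close>, the other one of the two, so only the pipe itself meets this
    end.\<close>
  then have "w = PB (bit_pipe k (y ! k))"
    using assms(4) by (auto simp: game_edges_def pipes_def eq_game_A_def eq_game_B_def
        doubleton_eq_iff)
  then show "w \<in> set ?p" by simp
qed simp

lemma computes_eq_game: "computes n (link_pipe n) eq_game_A eq_game_B EQ"
  unfolding computes_def
proof (intro ballI conjI impI)
  fix x y assume xy: "x \<in> bits n" "y \<in> bits n"
  {
    assume "EQ x y"
    then show "last (water_path (link_pipe n) eq_game_A eq_game_B x y) \<in> sideB (link_pipe n)"
      using water_path_eq_game_equal[OF xy(1)] by (simp add: EQ_def sideB_def)
  next
    assume "\<not> EQ x y"
    then have "\<exists>k. k < n \<and> x ! k \<noteq> y ! k"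
      using xy by (auto simp: EQ_def bits_def list_eq_iff_nth_eq)
    then obtain k where k: "k < n" "x ! k \<noteq> y ! k" "\<And>i. i < k \<Longrightarrow> x ! i = y ! i"
      using exists_least_iff[of "\<lambda>k. k < n \<and> x ! k \<noteq> y ! k"] by (metis less_trans)
    from k(1) show "last (water_path (link_pipe n) eq_game_A eq_game_B x y) \<in> sideA0 (link_pipe n)"
      by (simp add: water_path_eq_game_mismatch[OF xy k] sideA0_def sideA_def)
  }
qed

theorem mainTheorem6:
  fixes n :: nat
  assumes "n \<ge> 1"
  shows "GH n EQ \<le> enat (3 * n + 1)"
  \<comment> \<open>Folding turns the bound 3n + 1 into \<open>link_pipe n\<close>, the size of the
    game constructed.\<close>
  unfolding GH_def link_pipe_def[symmetric] using is_game_eq_game computes_eq_game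
  by (intro Inf_lower) blast

end
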